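(* Let $S$ be an acute $0/1$-simplex in $I^n=[0,1]^n$, let $v$ be a vertex of $S$, let $F$ be the $(n-1)$-dimensional facet of $S$ opposite $v$, and let $\hat S=\mathrm{conv}(F\cup\{\overline{v}\})$, where $\overline{v}=e^n-v$ is the antipodal vertex of $v$ in $I^n$ and $e^n$ is the all-ones vector. Then: (i) $F$ is not contained in any $(n-1)$-dimensional facet of $I^n$; (ii) every acute $0/1$-simplex in $I^n$ having $F$ as a facet and different from $S$ equals $\hat S$.
   Context: A $0/1$-simplex in $I^n$ is the convex hull of $n+1$ affinely independent points of $\{0,1\}^n$. The dihedral angle between two facets of an $n$-simplex is $\pi$ minus the angle between their inward normals; a simplex is acute if all its dihedral angles are less than $\pi/2$.
   Formalization: Part (i) is proved for n ≥ 2 only; for n = 1 it is false, since S = [0,1] is acute and its facet F, a single point, is itself a facet of I^1. Part (ii) is proved for all n ≥ 1. *)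

theory Defs
  imports "HOL-Analysis.Analysis"
begin

definition zero_one_simplex :: "(real^'n) set \<Rightarrow> bool" where
  "zero_one_simplex S \<longleftrightarrow>
     (\<exists>C. C \<subseteq> {x. \<forall>i. x $ i = 0 \<or> x $ i = 1} \<and>
          card C = CARD('n) + 1 \<and> \<not> affine_dependent C \<and> S = convex hull C)"

definition vector_angle :: "'a::real_inner \<Rightarrow> 'a \<Rightarrow> real" where
  "vector_angle a b = arccos (a \<bullet> b / (norm a * norm b))"

text \<open>Only meant for a facet \<open>F\<close> of a full-dimensional polytope \<open>S\<close>; there the normal exists and is
  unique, see \<open>ex1_inward_unit_normal\<close> below.\<close>

definition inward_unit_normal :: "'a::euclidean_space set \<Rightarrow> 'a set \<Rightarrow> 'a" where
  "inward_unit_normal S F =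
     (THE a. norm a = 1 \<and> (\<exists>b. S \<subseteq> {x. a \<bullet> x \<ge> b} \<and> F = S \<inter> {x. a \<bullet> x = b}))"

definition dihedral_angle :: "'a::euclidean_space set \<Rightarrow> 'a set \<Rightarrow> 'a set \<Rightarrow> real" where
  "dihedral_angle S F G = pi - vector_angle (inward_unit_normal S F) (inward_unit_normal S G)"

definition acute_simplex :: "'a::euclidean_space set \<Rightarrow> bool" where
  "acute_simplex S \<longleftrightarrow>
     (\<forall>F G. F facet_of S \<and> G facet_of S \<and> F \<noteq> G \<longrightarrow> dihedral_angle S F G < pi / 2)"

definition opposite_facet :: "'a::euclidean_space set \<Rightarrow> 'a \<Rightarrow> 'a set" where
  "opposite_facet S v = convex hull ({x. x extreme_point_of S} - {v})"

lemma ex1_inward_unit_normal: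
  fixes S :: "'a::euclidean_space set"
  assumes S: "polytope S" "aff_dim S = int DIM('a)" and F: "F facet_of S"
  shows "\<exists>!a. norm a = 1 \<and> (\<exists>b. S \<subseteq> {x. a \<bullet> x \<ge> b} \<and> F = S \<inter> {x. a \<bullet> x = b})"
    (is "\<exists>!a. ?P a")
proof (rule ex_ex1I)
  obtain a b where ab: "a \<noteq> 0" "S \<subseteq> {x. a \<bullet> x \<le> b}" "F = S \<inter> {x. a \<bullet> x = b}"
    using facet_of_polyhedron polytope_imp_polyhedron S(1) F by metis
  have "?P ((- 1 / norm a) *\<^sub>R a)"
  proof (intro conjI exI)
    show "S \<subseteq> {x. ((- 1 / norm a) *\<^sub>R a) \<bullet> x \<ge> - b / norm a}"
      using ab(1,2) by (auto simp: divide_right_mono)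
    show "F = S \<inter> {x. ((- 1 / norm a) *\<^sub>R a) \<bullet> x = - b / norm a}"
      using ab(1,3) by auto
  qed (use ab(1) in simp)
  then show "\<exists>a. ?P a" by blast
next
  fix a a' assume "?P a" "?P a'"
  then obtain b b' where n: "norm a = 1" "norm a' = 1"
    and b: "S \<subseteq> {x. a \<bullet> x \<ge> b}" "F = S \<inter> {x. a \<bullet> x = b}"
    and b': "S \<subseteq> {x. a' \<bullet> x \<ge> b'}" "F = S \<inter> {x. a' \<bullet> x = b'}" by blast
  have dim: "aff_dim F = int DIM('a) - 1" and ne: "F \<noteq> {}"
    using F S(2) by (auto simp: facet_of_def)
  have hull: "affine hull F = {x. c \<bullet> x = d}" if "c \<noteq> 0" "F \<subseteq> {x. c \<bullet> x = d}" for c d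
  proof (rule affine_dim_equal)
    show "affine hull F \<subseteq> {x. c \<bullet> x = d}"
      using that(2) by (rule hull_minimal) (rule affine_hyperplane)
  qed (use that ne dim in \<open>auto simp: affine_hyperplane\<close>)
  have "a \<noteq> 0" "a' \<noteq> 0" using n by auto
  then have eq: "{x. a \<bullet> x = b} = {x. a' \<bullet> x = b'}"
    using hull[of a b] hull[of a' b'] b(2) b'(2) by blast
  obtain p where p: "p \<in> F" using ne by blast
  define y where "y = a' - (a \<bullet> a') *\<^sub>R a"
  have "a \<bullet> y = 0" using n(1) by (simp add: y_def inner_diff_right dot_square_norm)
  then have "p + y \<in> {x. a \<bullet> x = b}" using p b(2) by (simp add: inner_add_right)
  then have "a' \<bullet> y = 0" using eq p b'(2) by (auto simp: inner_add_right)
  with \<open>a \<bullet> y = 0\<close> have "y \<bullet> y = 0"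
    by (subst (1) y_def) (simp add: inner_diff_left)
  then have a': "a' = (a \<bullet> a') *\<^sub>R a" by (simp add: y_def)
  have "F \<noteq> S" using dim S(2) by auto
  then obtain s where s: "s \<in> S" "a \<bullet> s > b" "a' \<bullet> s > b'"
    using b b' by (smt (verit) IntI Int_lower1 mem_Collect_eq subsetD subsetI subset_antisym)
  have "a \<bullet> (s - p) > 0" "a' \<bullet> (s - p) > 0"
    using s p b(2) b'(2) by (auto simp: inner_diff_right)
  moreover have "a' \<bullet> (s - p) = (a \<bullet> a') * (a \<bullet> (s - p))"
    by (subst a') simp
  ultimately have "a \<bullet> a' > 0" by (simp add: zero_less_mult_iff)
  moreover have "\<bar>a \<bullet> a'\<bar> = 1" using n arg_cong[OF a', of norm] by simp
  ultimately show "a = a'" using a' by simp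
qed

end

theory Submission
  imports Defs
begin

text \<open>Write the vertices of an acute 0/1-simplex as the points of \<open>C\<close>, and let \<open>g\<^sub>u\<close> be the
  gradient of the barycentric coordinate of \<open>u \<in> C\<close>; it is a positive multiple of the inward normal
  of the facet opposite \<open>u\<close>, so acuteness says that distinct gradients have negative inner product.
  The \<open>i\<close>-th coordinate function is the sum of the barycentric coordinates of the vertices in
  \<open>A = {u \<in> C. u\<^sub>i = 1}\<close>, hence \<open>e\<^sub>i = (\<Sum>u\<in>A. g\<^sub>u) = - (\<Sum>u\<in>C - A. g\<^sub>u)\<close>. Taking the inner product
  with \<open>g\<^sub>v\<close>, and using the sum that does not contain \<open>v\<close>, shows that the \<open>i\<close>-th entry of \<open>g\<^sub>v\<close> is
  positive if \<open>v\<^sub>i = 1\<close> and negative if \<open>v\<^sub>i = 0\<close>. So the normal of a facet has no zero entries,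
  and up to its orientation it determines the opposite vertex.\<close>

text \<open>A hyperplane containing a spanning set contains everything; comparing the values at
  \<open>0\<close> and \<open>d\<close> gives \<open>d \<bullet> d = 0\<close>.\<close>

lemma inner_const_affine_hull_UNIV:
  fixes d :: "'a::real_inner"
  assumes "affine hull C = UNIV" and "\<And>w. w \<in> C \<Longrightarrow> d \<bullet> w = \<beta>"
  shows "d = 0"
proof -
  have "affine {x. d \<bullet> x = \<beta>}"
    by (rule affine_hyperplane)
  then have "affine hull C \<subseteq> {x. d \<bullet> x = \<beta>}"
    using assms(2) by (intro hull_minimal) auto
  then have "d \<bullet> x = \<beta>" for x using assms(1) by blast
  from this[of 0] this[of d] have "d \<bullet> d = 0" by simp
  then show ?thesis by simp
qed

text \<open>Facet normals are unique up to scaling: subtracting the multiple of \<open>g\<close>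
  with the same jump at \<open>v\<close> leaves a functional constant on all of
  \<open>C\<close>.\<close>

lemma inner_const_on_facet:
  fixes d g :: "'a::real_inner"
  assumes "affine hull C = UNIV"
    and g: "g \<bullet> v = b + 1" "\<And>w. w \<in> C - {v} \<Longrightarrow> g \<bullet> w = b"
    and d: "\<And>w. w \<in> C - {v} \<Longrightarrow> d \<bullet> w = \<beta>"
  shows "d = (d \<bullet> v - \<beta>) *\<^sub>R g"
proof -
  define c where "c = d \<bullet> v - \<beta>"
  have "(d - c *\<^sub>R g) \<bullet> w = \<beta> - c * b" if "w \<in> C" for w
  proof (cases "w = v")
    case True
    then show ?thesis using g(1) by (simp add: inner_diff_left c_def algebra_simps)
  next
    case False
    then show ?thesis using g(2) d that by (simp add: inner_diff_left)
  qed
  then have "d - c *\<^sub>R g = 0" using assms(1) by (rule inner_const_affine_hull_UNIV[rotated])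
  then show ?thesis by (simp add: c_def)
qed

lemma not_in_convex_hull_Diff:
  assumes "\<not> affine_dependent C" "v \<in> C"
  shows "v \<notin> convex hull (C - {v})"
  using assms convex_hull_subset_affine_hull[of "C - {v}"] by (auto simp: affine_dependent_def)

lemma opposite_facet_of_simplex:
  fixes C :: "'a::euclidean_space set"
  assumes "\<not> affine_dependent C" "card C = DIM('a) + 1" "v \<in> C"
  shows "convex hull (C - {v}) facet_of convex hull C"
proof -
  have "card (C - {v}) \<noteq> 0" using assms(2,3) by simp
  then have "C - {v} \<noteq> {}" by (metis card.empty)
  then show ?thesis
    using assms by (auto simp: facet_of_convex_hull_affine_independent)
qed

text \<open>Turns the definite description into what is used later: the normal is constant on the
  facet's vertices and strictly larger at the opposite vertex.\<close>

lemma inward_unit_normal_simplex: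
  fixes C :: "'a::euclidean_space set"
  assumes C: "\<not> affine_dependent C" "card C = DIM('a) + 1" and v: "v \<in> C"
  defines "a \<equiv> inward_unit_normal (convex hull C) (convex hull (C - {v}))"
  obtains b where "norm a = 1" "a \<bullet> v > b" "\<And>w. w \<in> C - {v} \<Longrightarrow> a \<bullet> w = b"
proof -
  let ?S = "convex hull C" and ?F = "convex hull (C - {v})"
  have "finite C" using C(1) by (rule aff_independent_finite)
  then have poly: "polytope ?S" by (auto simp: polytope_def)
  have dim: "aff_dim ?S = int DIM('a)"
    using C aff_dim_affine_independent[OF C(1)] by (simp add: aff_dim_convex_hull)
  have "norm a = 1 \<and> (\<exists>b. ?S \<subseteq> {x. a \<bullet> x \<ge> b} \<and> ?F = ?S \<inter> {x. a \<bullet> x = b})"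
    unfolding a_def inward_unit_normal_def
    by (rule theI'[OF ex1_inward_unit_normal[OF poly dim opposite_facet_of_simplex[OF C v]]])
  then obtain b where b: "norm a = 1" "?S \<subseteq> {x. a \<bullet> x \<ge> b}" "?F = ?S \<inter> {x. a \<bullet> x = b}"
    by blast
  have "v \<in> ?S" "v \<notin> ?F" using v C(1) by (auto simp: hull_inc not_in_convex_hull_Diff)
  then have "a \<bullet> v > b" using b by force
  moreover have "a \<bullet> w = b" if "w \<in> C - {v}" for w
    using hull_inc[OF that, of convex] b(3) by blast
  ultimately show ?thesis using that b(1) by blast
qed

lemma vector_angle_obtuse_imp_inner_neg:
  assumes "vector_angle a b > pi / 2"
  shows "a \<bullet> b < 0"
proof (rule ccontr)
  assume "\<not> a \<bullet> b < 0"
  then have "0 \<le> a \<bullet> b / (norm a * norm b)" by simp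
  moreover have "a \<bullet> b / (norm a * norm b) \<le> 1"
    using norm_cauchy_schwarz[of a b] by (intro divide_le_eq_1[THEN iffD2]) (auto simp: less_le)
  ultimately have "vector_angle a b \<le> pi / 2"
    unfolding vector_angle_def by (rule arccos_le_pi2)
  then show False using assms by simp
qed

text \<open>An acute dihedral angle means an obtuse angle between the normals. The two facets differ
  because \<open>u\<close> lies only in the one opposite \<open>v\<close>.\<close>

lemma acute_simplex_inner_normals_neg:
  fixes C :: "'a::euclidean_space set"
  assumes C: "\<not> affine_dependent C" "card C = DIM('a) + 1"
    and acute: "acute_simplex (convex hull C)" and uv: "u \<in> C" "v \<in> C" "u \<noteq> v"
  shows "inward_unit_normal (convex hull C) (convex hull (C - {u})) \<bullet>
    inward_unit_normal (convex hull C) (convex hull (C - {v})) < 0"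
proof -
  have "u \<in> convex hull (C - {v})" using uv by (simp add: hull_inc)
  then have "convex hull (C - {u}) \<noteq> convex hull (C - {v})"
    using not_in_convex_hull_Diff[OF C(1) uv(1)] by auto
  then have "dihedral_angle (convex hull C) (convex hull (C - {u})) (convex hull (C - {v})) < pi / 2"
    using acute opposite_facet_of_simplex[OF C] uv unfolding acute_simplex_def by blast
  then show ?thesis
    by (intro vector_angle_obtuse_imp_inner_neg) (simp add: dihedral_angle_def)
qed

lemma acute_zero_one_simplex_normal_sign:
  fixes C :: "(real^'n) set"
  assumes C: "\<not> affine_dependent C" "card C = CARD('n) + 1"
    and bin: "C \<subseteq> {x. \<forall>i. x $ i = 0 \<or> x $ i = 1}"
    and acute: "acute_simplex (convex hull C)" and v: "v \<in> C"
  obtains g b where "g \<bullet> v = b + 1" "\<And>w. w \<in> C - {v} \<Longrightarrow> g \<bullet> w = b"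
    "\<And>i. v $ i = 1 \<Longrightarrow> g $ i > 0" "\<And>i. v $ i = 0 \<Longrightarrow> g $ i < 0"
proof -
  have C': "card C = DIM(real^'n) + 1" using C(2) by simp
  have fin: "finite C" using C(1) by (rule aff_independent_finite)
  have hull: "affine hull C = UNIV"
    using C(1) C' by (intro affine_independent_span_gt) auto
  define a where "a u = inward_unit_normal (convex hull C) (convex hull (C - {u}))" for u
  have "\<exists>b. a u \<bullet> u > b \<and> (\<forall>w \<in> C - {u}. a u \<bullet> w = b)" if "u \<in> C" for u
    using inward_unit_normal_simplex[OF C(1) C' that] unfolding a_def by metis
  then obtain b where b: "\<And>u. u \<in> C \<Longrightarrow> a u \<bullet> u > b u"
      "\<And>u w. u \<in> C \<Longrightarrow> w \<in> C \<Longrightarrow> w \<noteq> u \<Longrightarrow> a u \<bullet> w = b u"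
    by (metis Diff_iff singletonD)
  \<comment> \<open>This scaling makes \<open>g u\<close> increase by exactly 1 from the facet
    opposite \<open>u\<close> to \<open>u\<close>, as a barycentric coordinate does.\<close>
  define h where "h u = inverse (a u \<bullet> u - b u)" for u
  have h: "h u > 0" if "u \<in> C" for u using b(1)[OF that] by (simp add: h_def)
  define g where "g u = h u *\<^sub>R a u" for u
  have g: "g u \<bullet> w = h u * b u + (if w = u then 1 else 0)" if "u \<in> C" "w \<in> C" for u w
    using b[OF that(1)] that by (auto simp: g_def h_def field_simps)
  have neg: "g u \<bullet> g w < 0" if "u \<in> C" "w \<in> C" "u \<noteq> w" for u w
    using acute_simplex_inner_normals_neg[OF C(1) C' acute that] h that
    by (simp add: g_def a_def mult_pos_neg)
  have sum_g: "(\<Sum>u\<in>A. g u) \<bullet> w = (\<Sum>u\<in>A. h u * b u) + (if w \<in> A then 1 else 0)"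
    if "A \<subseteq> C" "w \<in> C" for A w
    using that g finite_subset[OF that(1) fin]
    by (simp add: inner_sum_left subset_iff sum.distrib cong: sum.cong)
  show ?thesis
  proof (rule that[of "g v" "h v * b v"])
    fix i
    define A where "A = {u \<in> C. u $ i = 1}"
    define B where "B = {u \<in> C. u $ i = 0}"
    have AB: "A \<subseteq> C" "B \<subseteq> C" by (auto simp: A_def B_def)
    have coord: "w $ i = (if w \<in> A then 1 else 0)" "w $ i = 1 - (if w \<in> B then 1 else 0)"
      if "w \<in> C" for w
      using bin that by (auto simp: A_def B_def)
    \<comment> \<open>On \<open>C\<close>, both functionals equal the indicator of \<open>A\<close>
      up to an additive constant.\<close>
    have "axis i 1 - (\<Sum>u\<in>A. g u) = 0"
      by (rule inner_const_affine_hull_UNIV[OF hull, where \<beta> = "- (\<Sum>u\<in>A. h u * b u)"])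
        (simp add: inner_diff_left sum_g AB inner_axis' coord(1))
    then have axA: "axis i 1 = (\<Sum>u\<in>A. g u)" by simp
    have "axis i 1 + (\<Sum>u\<in>B. g u) = 0"
      by (rule inner_const_affine_hull_UNIV[OF hull, where \<beta> = "1 + (\<Sum>u\<in>B. h u * b u)"])
        (simp add: inner_add_left sum_g AB inner_axis' coord(2))
    then have axB: "axis i 1 = - (\<Sum>u\<in>B. g u)" by (simp add: eq_neg_iff_add_eq_0)
    have "g v $ i = axis i 1 \<bullet> g v" by (simp add: inner_axis')
    then have eA: "g v $ i = (\<Sum>u\<in>A. g u \<bullet> g v)" and eB: "g v $ i = - (\<Sum>u\<in>B. g u \<bullet> g v)"
      by (simp add: axA inner_sum_left, simp add: axB inner_sum_left)
    \<comment> \<open>An empty \<open>A\<close> or \<open>B\<close> would give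
      \<open>axis i 1 = 0\<close>. Nonemptiness makes the sums of negative terms below strictly
      negative.\<close>
    have "(axis i 1 :: real^'n) \<noteq> 0" by (simp add: axis_eq_0_iff)
    then have ne: "A \<noteq> {}" "B \<noteq> {}" using axA axB by auto
    have finAB: "finite A" "finite B" using AB fin finite_subset by auto
    show "g v $ i > 0" if "v $ i = 1"
    proof -
      have "(\<Sum>u\<in>B. g u \<bullet> g v) < (\<Sum>u\<in>B. 0)"
        using that by (intro sum_strict_mono finAB ne neg v) (auto simp: B_def)
      then show ?thesis using eB by simp
    qed
    show "g v $ i < 0" if "v $ i = 0"
    proof -
      have "(\<Sum>u\<in>A. g u \<bullet> g v) < (\<Sum>u\<in>A. 0)"
        using that by (intro sum_strict_mono finAB ne neg v) (auto simp: A_def)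
      then show ?thesis using eA by simp
    qed
  qed (use g v in auto)
qed

text \<open>Moving one coordinate within the cube in the direction of increase shows that a functional
  without zero entries attains its maximum only once.\<close>

lemma maximizer_cube_unique:
  fixes a x y :: "real^'n"
  assumes max: "\<And>z. z \<in> cbox 0 1 \<Longrightarrow> a \<bullet> z \<le> b" and nz: "\<And>i. a $ i \<noteq> 0"
    and bin: "\<And>i. x $ i = 0 \<or> x $ i = 1" "\<And>i. y $ i = 0 \<or> y $ i = 1"
    and eq: "a \<bullet> x = b" "a \<bullet> y = b"
  shows "x = y"
proof (rule ccontr)
  assume "x \<noteq> y"
  then obtain i where "x $ i \<noteq> y $ i" by (auto simp: vec_eq_iff)
  then obtain p q where pq: "a \<bullet> p = b" "a \<bullet> q = b" "p $ i = 0" "q $ i = 1"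
      and p: "\<And>i. p $ i = 0 \<or> p $ i = 1" and q: "\<And>i. q $ i = 0 \<or> q $ i = 1"
    using eq bin by metis
  \<comment> \<open>Both moves stay in the cube; one forces \<open>a $ i \<le> 0\<close>, the other
    \<open>a $ i \<ge> 0\<close>.\<close>
  have "p + axis i 1 \<in> cbox 0 1" "q - axis i 1 \<in> cbox 0 1"
    using pq p q by (auto simp: mem_box_cart axis_def) (metis order.refl zero_le_one)+
  then have "a \<bullet> (p + axis i 1) \<le> b" "a \<bullet> (q - axis i 1) \<le> b" using max by auto
  then have "a $ i = 0" using pq by (simp add: inner_add_right inner_diff_right inner_axis)
  then show False using nz by blast
qed

theorem theorem6p1:
  fixes S F :: "(real^'n) set" and v :: "real^'n"
  assumes "zero_one_simplex S"
    and "acute_simplex S"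
    and "v extreme_point_of S"
    and "F = opposite_facet S v"
  shows "(CARD('n) \<ge> 2 \<longrightarrow> \<not> (\<exists>G. G facet_of cbox 0 (1 :: real^'n) \<and> F \<subseteq> G)) \<and>
         (\<forall>T. zero_one_simplex T \<and> acute_simplex T \<and> F facet_of T \<and> T \<noteq> S
                \<longrightarrow> T = convex hull (F \<union> {1 - v}))"
proof -
  obtain C where bin: "C \<subseteq> {x. \<forall>i. x $ i = 0 \<or> x $ i = 1}" and card: "card C = CARD('n) + 1"
    and ind: "\<not> affine_dependent C" and S: "S = convex hull C"
    using assms(1) unfolding zero_one_simplex_def by blast
  have v: "v \<in> C" and F: "F = convex hull (C - {v})"
    using assms(3,4) ind
    by (auto simp: S opposite_facet_def extreme_point_of_convex_hull_affine_independent)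
  have hull: "affine hull C = UNIV"
    using ind card by (intro affine_independent_span_gt) auto
  obtain g b where g: "g \<bullet> v = b + 1" "\<And>w. w \<in> C - {v} \<Longrightarrow> g \<bullet> w = b"
    and sign: "\<And>i. v $ i = 1 \<Longrightarrow> g $ i > 0" "\<And>i. v $ i = 0 \<Longrightarrow> g $ i < 0"
    using acute_zero_one_simplex_normal_sign[OF ind card bin assms(2)[unfolded S] v] by blast
  have v01: "v $ i = 0 \<or> v $ i = 1" for i using bin v by auto
  have g_nz: "g $ i \<noteq> 0" for i using v01[of i] sign[of i] by auto
  note normal = inner_const_on_facet[OF hull g]
  have part1: False if "CARD('n) \<ge> 2" "G facet_of cbox 0 (1 :: real^'n)" "F \<subseteq> G" for G
  proof -
    obtain a \<beta> where a: "a \<noteq> 0" "cbox 0 1 \<subseteq> {x. a \<bullet> x \<le> \<beta>}" "G = cbox 0 1 \<inter> {x. a \<bullet> x = \<beta>}"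
      using facet_of_polyhedron[OF polyhedron_interval \<open>G facet_of cbox 0 1\<close>] by metis
    have on: "a \<bullet> w = \<beta>" if "w \<in> C - {v}" for w
      using hull_inc[OF that, of convex] \<open>F \<subseteq> G\<close> a(3) F by blast
    have "a = (a \<bullet> v - \<beta>) *\<^sub>R g" by (rule normal[OF _ on])
    then have a_nz: "a $ i \<noteq> 0" for i
      using a(1) g_nz[of i]
      by (metis mult_eq_0_iff real_scaleR_def scaleR_eq_0_iff vector_scaleR_component)
    \<comment> \<open>From dimension 2 on, \<open>F\<close> has two distinct vertices, and both
      would maximize \<open>a\<close> over the cube.\<close>
    have "\<not> card (C - {v}) \<le> Suc 0" using card v \<open>CARD('n) \<ge> 2\<close> by simp
    then obtain x y where xy: "x \<in> C - {v}" "y \<in> C - {v}" "x \<noteq> y"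
      using card_le_Suc0_iff_eq[OF finite_Diff[OF aff_independent_finite[OF ind]]] by blast
    have "x = y"
      by (rule maximizer_cube_unique[of a \<beta>]) (use a(2) a_nz xy bin on in auto)
    with xy show False by blast
  qed
  have part2: "T = convex hull (F \<union> {1 - v})"
    if T: "zero_one_simplex T" "acute_simplex T" "F facet_of T" "T \<noteq> S" for T
  proof -
    obtain D where Dbin: "D \<subseteq> {x. \<forall>i. x $ i = 0 \<or> x $ i = 1}" and Dcard: "card D = CARD('n) + 1"
      and Dind: "\<not> affine_dependent D" and TD: "T = convex hull D"
      using T(1) unfolding zero_one_simplex_def by blast
    obtain w where w: "w \<in> D" "F = convex hull (D - {w})"
      using T(3) Dind by (auto simp: TD facet_of_convex_hull_affine_independent)
    \<comment> \<open>The extreme points of \<open>F\<close> recover its vertices, so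
      \<open>C\<close> and \<open>D\<close> can differ only in the vertex opposite
      \<open>F\<close>.\<close>
    have "C - {v} = {x. x extreme_point_of F}"
      using ind
      by (auto simp: F extreme_point_of_convex_hull_affine_independent affine_independent_Diff)
    moreover have "D - {w} = {x. x extreme_point_of F}"
      using Dind
      by (auto simp: w(2) extreme_point_of_convex_hull_affine_independent affine_independent_Diff)
    ultimately have CD: "D - {w} = C - {v}" by simp
    obtain g' b' where g': "g' \<bullet> w = b' + 1" "\<And>x. x \<in> D - {w} \<Longrightarrow> g' \<bullet> x = b'"
      and sign': "\<And>i. w $ i = 1 \<Longrightarrow> g' $ i > 0" "\<And>i. w $ i = 0 \<Longrightarrow> g' $ i < 0"
      using acute_zero_one_simplex_normal_sign[OF Dind Dcard Dbin T(2)[unfolded TD] w(1)] by blast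
    define c where "c = g' \<bullet> v - b'"
    have "g' = c *\<^sub>R g" unfolding c_def by (rule normal[of g' b']) (use g'(2) CD in auto)
    then have gi: "g' $ i = c * g $ i" for i by simp
    have w01: "w $ i = 0 \<or> w $ i = 1" for i using Dbin w(1) by auto
    have "w \<noteq> v"
    proof
      assume "w = v"
      then have "D = C" using CD w(1) v by blast
      then show False using T(4) S TD by simp
    qed
    \<comment> \<open>The sign of \<open>c\<close> tells whether both simplices lie on the same side
      of \<open>F\<close>. If \<open>c > 0\<close>, the sign patterns agree and force
      \<open>w = v\<close>, a contradiction. Otherwise they are opposite; \<open>c = 0\<close> is
      excluded because \<open>g'\<close> has no zero entries.\<close>
    have "w = 1 - v"
    proof (cases "c > 0")
      case True
      have "w $ i = v $ i" for i
        using v01[of i] w01[of i] sign[of i] sign'[of i] True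
        by (auto simp: gi zero_less_mult_iff mult_less_0_iff)
      then show ?thesis using \<open>w \<noteq> v\<close> by (simp add: vec_eq_iff)
    next
      case False
      have "w $ i = 1 - v $ i" for i
        using v01[of i] w01[of i] sign[of i] sign'[of i] False
        by (auto simp: gi zero_less_mult_iff mult_less_0_iff)
      then show ?thesis by (simp add: vec_eq_iff)
    qed
    then have "D = (C - {v}) \<union> {1 - v}" using CD w(1) by blast
    then show ?thesis by (simp only: TD F flip: hull_Un_left)
  qed
  show ?thesis using part1 part2 by blast
qed

end
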